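(* For $n\ge 1$ let $$f_n(\bar t,x,y,z) := \sum_{\pi\in T_n} t_{\mathrm{Des}(\pi^{-1})}\, x^{\mathrm{inv}(\pi)} y^{\mathrm{ldes}(\pi)} z^{\mathrm{lind}(\pi)}.$$ Then $$f_1(\bar t,x,y,z)=z$$ and, for $n\ge 2$, $$\begin{aligned} (x-yz)f_n(\bar t,x,y,z) ={}& t_{n-1}x^{n}yz \cdot f_{n-1}(\bar t,x,yz/x,1) + (1-t_{n-1})x^{n}yz \cdot f_{n-1}(\bar t,x,1,yz/x)\\ & + (x-yz)z^{n} \cdot f_{n-1}(\bar t,x,y,1) - xy^{n}z^{n} \cdot f_{n-1}(\bar t,x,1,1). \end{aligned}$$
   Context: $S_n$ is the symmetric group on $\{1,\dots,n\}$, and $T_n$ is the set of $321$-avoiding permutations: all $\pi\in S_n$ for which there are no $i<j<k$ with $\pi(i)>\pi(j)>\pi(k)$. For $\pi\in T_n$: $\mathrm{inv}(\pi)$ is the number of inversions of $\pi$; $\mathrm{ldes}(\pi)=\max\{1\le i\le n-1 \mid \pi(i)>\pi(i+1)\}$, with $\mathrm{ldes}(\mathrm{id}):=0$; $\mathrm{lind}(\pi)=\pi^{-1}(n)$; $\mathrm{Des}(\pi^{-1})=\{1\le i\le n-1\mid \pi^{-1}(i)>\pi^{-1}(i+1)\}$. Here $\bar t=(t_1,t_2,\dots)$, $x,y,z$ are commuting indeterminates, and $t_D:=\prod_{i\in D}t_i$ for $D\subseteq\{1,\dots,n-1\}$. Expressions such as $f_{n-1}(\bar t,x,yz/x,1)$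 denote substitution of the listed values for the arguments $x,y,z$ respectively; the identity is one of rational functions (Laurent polynomials in $x$). *)

theory Defs
  imports
    "HOL-Combinatorics.Permutations"
    "HOL-Library.Poly_Mapping"
    "HOL-Computational_Algebra.Fraction_Field"
begin

section \<open>Permutation statistics\<close>

text \<open>Elements of $S_n$ are functions \<^term>\<open>p :: nat \<Rightarrow> nat\<close> with \<^term>\<open>p permutes {1..n}\<close>,
  so they are the identity outside of \<^term>\<open>{1..n}\<close>.\<close>

definition avoids_321 :: "nat \<Rightarrow> (nat \<Rightarrow> nat) \<Rightarrow> bool" where
  "avoids_321 n p \<longleftrightarrow>
     \<not> (\<exists>i j k. 1 \<le> i \<and> i < j \<and> j < k \<and> k \<le> n \<and> p i > p j \<and> p j > p k)"

definition T_perms :: "nat \<Rightarrow> (nat \<Rightarrow> nat) set" where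
  "T_perms n = {p. p permutes {1..n} \<and> avoids_321 n p}"

definition inv_number :: "nat \<Rightarrow> (nat \<Rightarrow> nat) \<Rightarrow> nat" where
  "inv_number n p = card {(i, j). 1 \<le> i \<and> i < j \<and> j \<le> n \<and> p i > p j}"

definition Des :: "nat \<Rightarrow> (nat \<Rightarrow> nat) \<Rightarrow> nat set" where
  "Des n p = {i \<in> {1..n - 1}. p i > p (i + 1)}"

definition ldes :: "nat \<Rightarrow> (nat \<Rightarrow> nat) \<Rightarrow> nat" where
  "ldes n p = (if Des n p = {} then 0 else Max (Des n p))"

definition lind :: "nat \<Rightarrow> (nat \<Rightarrow> nat) \<Rightarrow> nat" where
  "lind n p = inv p n"


section \<open>The generating function\<close>

text \<open>The arguments range over an arbitrary commutative semiring: at indeterminates \<open>f_gen n\<close> is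
  the generating function itself, and applying it to other arguments is substitution.\<close>

definition f_gen ::
  "nat \<Rightarrow> (nat \<Rightarrow> 'a) \<Rightarrow> 'a \<Rightarrow> 'a \<Rightarrow> 'a \<Rightarrow> 'a :: comm_semiring_1" where
  "f_gen n t x y z =
     (\<Sum>p\<in>T_perms n. (\<Prod>i\<in>Des n (inv p). t i) * x ^ inv_number n p * y ^ ldes n p * z ^ lind n p)"


section \<open>Indeterminates and rational functions\<close>

text \<open>Polynomials over the integers in indeterminates indexed by \<^typ>\<open>nat\<close> are finitely supported
  functions from monomials (exponent vectors) to coefficients, multiplied by convolution;
  their field of fractions consists of the rational functions.\<close>

type_synonym ratfun = "((nat \<Rightarrow>\<^sub>0 nat) \<Rightarrow>\<^sub>0 int) fract"

definition indet :: "nat \<Rightarrow> ratfun" where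
  "indet v = Fract (Poly_Mapping.single (Poly_Mapping.single v 1) 1) 1"

definition var_x :: ratfun where "var_x = indet 0"
definition var_y :: ratfun where "var_y = indet 1"
definition var_z :: ratfun where "var_z = indet 2"

text \<open>The shift by 3 keeps these apart from the three indeterminates above.\<close>

definition var_t :: "nat \<Rightarrow> ratfun" where "var_t i = indet (i + 3)"

end

theory Submission
  imports Defs
begin

text \<open>
  Deleting the largest entry \<open>m + 1\<close> of a permutation in $T_{m+1}$ leaves a permutation
  \<open>p\<close> in $T_m$. Conversely, \<open>m + 1\<close> may be inserted into \<open>p\<close> at position \<open>k\<close>
  exactly if the entries from position \<open>k\<close> onwards increase, that is, if
  \<open>ldes p < k \<le> m + 1\<close> (lemma \<open>avoids_321_insert_max_iff\<close>). The insertion changes the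
  statistics in a simple way. It creates the \<open>m + 1 - k\<close> inversions that involve \<open>m + 1\<close>;
  the last descent moves to \<open>k\<close>, unless \<open>k = m + 1\<close>, when it stays; the new index of the
  largest entry is \<open>k\<close>; and \<open>m\<close> joins the descent set of the inverse exactly if \<open>m + 1\<close>
  lands to the left of \<open>m\<close>, that is, if \<open>k \<le> lind p\<close>.

  With \<open>d = ldes p\<close>, \<open>l = lind p\<close>, where \<open>d \<le> l \<le> m\<close>, and \<open>u = y * z\<close>, the
  children of \<open>p\<close>, the permutations obtained from it by insertion, contribute the weight of \<open>p\<close> times
  \[ t_m \sum_{d<k\le l} x^{m+1-k}u^k + \sum_{l<k\le m} x^{m+1-k}u^k + y^d z^{m+1}. \]
  Multiplying by \<open>x - u\<close> telescopes both geometric sums; with \<open>q = u / x\<close> they become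
  $x^{m+1}u(q^d-q^l)$ and $x^{m+1}u(q^l-q^m)$. Collecting the terms with
  $q^d$, $q^l$, $q^m$ and $y^d$ and summing over \<open>p\<close> gives the four terms of the recurrence.
  The argument works in every field with \<open>x \<noteq> 0\<close> (lemma \<open>f_gen_Suc\<close>).
\<close>

section \<open>Last descents\<close>

lemma finite_Des [simp]: "finite (Des n p)"
  unfolding Des_def by simp

text \<open>Positivity of \<open>k\<close> accounts for the value 0 given to a permutation without descents.\<close>

lemma ldes_less_iff:
  assumes "1 \<le> k"
  shows "ldes m p < k \<longleftrightarrow> (\<forall>i. k \<le> i \<and> i < m \<longrightarrow> p i \<le> p (Suc i))"
proof -
  have "ldes m p < k \<longleftrightarrow> (\<forall>i\<in>Des m p. i < k)"
    using assms by (auto simp: ldes_def)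
  also have "\<dots> \<longleftrightarrow> (\<forall>i. k \<le> i \<and> i < m \<longrightarrow> p i \<le> p (Suc i))"
  proof safe
    fix i
    assume "\<forall>i\<in>Des m p. i < k" "k \<le> i" "i < m"
    moreover from this have "i \<notin> Des m p" by auto
    ultimately show "p i \<le> p (Suc i)"
      using assms by (auto simp: Des_def not_less)
  next
    fix i
    assume "\<forall>i. k \<le> i \<and> i < m \<longrightarrow> p i \<le> p (Suc i)" "i \<in> Des m p"
    then show "i < k"
      by (auto simp: Des_def not_le[symmetric])
  qed
  finally show ?thesis .
qed

lemma le_if_ldes_less:
  assumes "ldes m p < k" "k \<le> i" "i \<le> j" "j \<le> m"
  shows "p i \<le> p j"
  using assms(3,4)
proof (induction j rule: dec_induct)
  case (step j)
  have "p j \<le> p (Suc j)"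
    using assms(1,2) step ldes_less_iff[of k m p] by simp
  then show ?case
    using step by simp
qed simp

lemma T_permsD:
  assumes "p \<in> T_perms m"
  shows "p permutes {1..m}" "avoids_321 m p"
  using assms by (auto simp: T_perms_def)

lemma finite_T_perms [simp]: "finite (T_perms m)"
  unfolding T_perms_def by (rule finite_subset[OF _ finite_permutations[of "{1..m}"]]) auto

lemma lind_bounds:
  assumes "p permutes {1..m}" "1 \<le> m"
  shows "lind m p \<in> {1..m}"
  unfolding lind_def using permutes_in_image[OF permutes_inv[OF assms(1)]] assms(2) by simp

text \<open>A descent to the right of the largest entry would complete a 321-pattern with it.\<close>

lemma ldes_le_lind:
  assumes "p \<in> T_perms m" "1 \<le> m"
  shows "ldes m p \<le> lind m p"
proof -
  note p = T_permsD[OF assms(1)]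
  have l: "lind m p \<in> {1..m}" "p (lind m p) = m"
    using lind_bounds[OF p(1) assms(2)] permutes_inverses(1)[OF p(1)] by (auto simp: lind_def)
  have "p i \<le> p (Suc i)" if i: "Suc (lind m p) \<le> i" "i < m" for i
  proof (rule ccontr)
    assume "\<not> p i \<le> p (Suc i)"
    moreover have "p i \<le> m"
      using permutes_in_image[OF p(1), of i] i by simp
    moreover have "p i \<noteq> p (lind m p)"
      using i permutes_inj[OF p(1)] by (metis injD not_less_eq_eq order_refl)
    ultimately show False
      using p(2) i l unfolding avoids_321_def
      by (metis atLeastAtMost_iff le_neq_implies_less lessI not_le Suc_le_eq)
  qed
  then have "ldes m p < Suc (lind m p)"
    by (subst ldes_less_iff) auto
  then show ?thesis by simp
qed

section \<open>Inserting a new largest entry\<close>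

text \<open>The map that sends the old positions \<open>1, \<dots>, m\<close> increasingly to the positions other
  than \<open>k\<close>, and \<open>m + 1\<close> to the freed position \<open>k\<close>. Having \<open>m + 1\<close> in its
  domain makes it a permutation, so that insertion becomes composition.\<close>

definition make_room :: "nat \<Rightarrow> nat \<Rightarrow> nat \<Rightarrow> nat" where
  "make_room m k j = (if j = Suc m then k else if k \<le> j \<and> j \<le> m then Suc j else j)"

definition insert_max :: "nat \<Rightarrow> nat \<Rightarrow> (nat \<Rightarrow> nat) \<Rightarrow> nat \<Rightarrow> nat" where
  "insert_max m k p = p \<circ> inv (make_room m k)"

lemma make_room_less_iff:
  assumes "i \<le> m" "j \<le> m"
  shows "make_room m k i < make_room m k j \<longleftrightarrow> i < j"
  using assms by (auto simp: make_room_def)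

lemma less_make_room_iff: "j \<le> m \<Longrightarrow> k < make_room m k j \<longleftrightarrow> k \<le> j"
  by (auto simp: make_room_def)

lemma make_room_Suc [simp]: "make_room m k (Suc m) = k"
  by (simp add: make_room_def)

lemma make_room_permutes:
  assumes "k \<in> {1..Suc m}"
  shows "make_room m k permutes {1..Suc m}"
proof (rule bij_imp_permutes)
  have "inj_on (make_room m k) {1..Suc m}"
    using assms by (auto simp: inj_on_def make_room_def split: if_splits)
  moreover have "make_room m k ` {1..Suc m} \<subseteq> {1..Suc m}"
    using assms by (auto simp: make_room_def)
  ultimately show "bij_betw (make_room m k) {1..Suc m} {1..Suc m}"
    by (simp add: bij_betw_def endo_inj_surj)
qed (use assms in \<open>auto simp: make_room_def\<close>)

lemma make_room_bounds:
  assumes "k \<in> {1..Suc m}" "j \<in> {1..Suc m}"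
  shows "1 \<le> make_room m k j" "make_room m k j \<le> Suc m"
  using permutes_in_image[OF make_room_permutes[OF assms(1)], of j] assms(2) by auto

lemma insert_max_make_room:
  assumes "k \<in> {1..Suc m}"
  shows "insert_max m k p (make_room m k j) = p j"
  by (simp add: insert_max_def permutes_inverses(2)[OF make_room_permutes[OF assms]])

lemma insert_max_at:
  assumes "k \<in> {1..Suc m}" "p permutes {1..m}"
  shows "insert_max m k p k = Suc m"
  using insert_max_make_room[OF assms(1), of p "Suc m"] permutes_not_in[OF assms(2), of "Suc m"]
  by simp

lemma position_cases:
  assumes "k \<in> {1..Suc m}" "i \<in> {1..Suc m}"
  obtains "i = k" | j where "i = make_room m k j" "j \<in> {1..m}"
proof -
  have "i \<in> make_room m k ` {1..Suc m}"
    using permutes_image[OF make_room_permutes[OF assms(1)]] assms(2) by simp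
  then obtain j where j: "i = make_room m k j" "j \<in> {1..Suc m}" by blast
  show ?thesis
    using j by (cases "j = Suc m") (auto intro: that)
qed

lemma insert_max_permutes:
  assumes "k \<in> {1..Suc m}" "p permutes {1..m}"
  shows "insert_max m k p permutes {1..Suc m}"
  unfolding insert_max_def using assms
  by (intro permutes_compose permutes_inv make_room_permutes) (auto intro: permutes_subset)

lemma insert_max_le:
  assumes "k \<in> {1..Suc m}" "p permutes {1..m}" "i \<in> {1..Suc m}"
  shows "insert_max m k p i \<le> Suc m"
  using permutes_in_image[OF insert_max_permutes[OF assms(1,2)], of i] assms(3) by auto

lemma inv_insert_max:
  assumes "k \<in> {1..Suc m}" "p permutes {1..m}"
  shows "inv (insert_max m k p) i = make_room m k (inv p i)"
  using insert_max_make_room[OF assms(1), of p "inv p i"]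
    permutes_inverses(1)[OF assms(2)] permutes_inv_eq[OF insert_max_permutes[OF assms]]
  by simp

text \<open>In a 321-pattern of the extended permutation, the new entry can only play the part
  of 3; the other two entries are then a pair out of order among the entries to its right.\<close>

lemma avoids_321_insert_max_iff:
  assumes k: "k \<in> {1..Suc m}" and p: "p permutes {1..m}"
  shows "avoids_321 (Suc m) (insert_max m k p) \<longleftrightarrow> avoids_321 m p \<and> ldes m p < k"
proof
  let ?q = "insert_max m k p" and ?e = "make_room m k"
  note q_e = insert_max_make_room[OF k, of p]
  note q_k = insert_max_at[OF k p]
  assume q: "avoids_321 (Suc m) ?q"
  have no_pattern: False
    if "1 \<le> a" "a < b" "b < c" "c \<le> Suc m" "?q a > ?q b" "?q b > ?q c" for a b c
    using q that unfolding avoids_321_def by blast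
  have "avoids_321 m p"
    unfolding avoids_321_def
  proof (safe)
    fix a b c
    assume "1 \<le> a" "a < b" "b < c" "c \<le> m" "p b < p a" "p c < p b"
    then show False
      using no_pattern[of "?e a" "?e b" "?e c"] make_room_bounds[OF k, of a]
        make_room_bounds[OF k, of c]
      by (simp add: q_e make_room_less_iff)
  qed
  moreover have "ldes m p < k"
  proof (subst ldes_less_iff)
    show "1 \<le> k" using k by simp
    show "\<forall>i. k \<le> i \<and> i < m \<longrightarrow> p i \<le> p (Suc i)"
    proof (safe, rule ccontr)
      fix i
      assume i: "k \<le> i" "i < m" "\<not> p i \<le> p (Suc i)"
      moreover have "p i \<le> m"
        using permutes_in_image[OF p, of i] i k by auto
      ultimately show False
        using no_pattern[of k "?e i" "?e (Suc i)"] k make_room_bounds[OF k, of "Suc i"]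
        by (simp add: q_e q_k make_room_less_iff less_make_room_iff)
    qed
  qed
  ultimately show "avoids_321 m p \<and> ldes m p < k" ..
next
  let ?q = "insert_max m k p" and ?e = "make_room m k"
  note q_e = insert_max_make_room[OF k, of p]
  note q_le = insert_max_le[OF k p]
  note q_k = insert_max_at[OF k p]
  assume p': "avoids_321 m p \<and> ldes m p < k"
  show "avoids_321 (Suc m) ?q"
    unfolding avoids_321_def
  proof (safe)
    fix a b c
    assume abc: "1 \<le> a" "a < b" "b < c" "c \<le> Suc m" "?q b < ?q a" "?q c < ?q b"
    have "b \<noteq> k" "c \<noteq> k"
      using q_le[of a] q_le[of b] abc q_k by auto
    moreover have "b \<in> {1..Suc m}" "c \<in> {1..Suc m}"
      using abc by auto
    ultimately obtain b' c' where
      b': "b = ?e b'" "b' \<in> {1..m}" and c': "c = ?e c'" "c' \<in> {1..m}"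
      by (metis position_cases[OF k])
    have b'c': "b' < c'" "p c' < p b'"
      using abc b' c' by (simp_all add: q_e make_room_less_iff)
    show False
      using k
    proof (rule position_cases[where i = a])
      assume "a = k"
      then have "k \<le> b'"
        using abc b' by (simp add: less_make_room_iff)
      then show False
        using le_if_ldes_less[of m p k b' c'] p' b'c' c' by simp
    next
      fix a'
      assume a': "a = ?e a'" "a' \<in> {1..m}"
      then have "a' < b'" "p b' < p a'"
        using abc b' by (simp_all add: q_e make_room_less_iff)
      then show False
        using p' b'c' a' c' unfolding avoids_321_def by auto
    qed (use abc in auto)
  qed
qed

text \<open>This turns a sum over $T_{m+1}$ into a double sum over $T_m$ and the admissible
  positions. Deletion, the inverse map, looks up the position of the largest entry and closes
  the gap.\<close>

lemma bij_betw_insert_max: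
  "bij_betw (\<lambda>(p, k). insert_max m k p)
     (SIGMA p:T_perms m. {ldes m p<..Suc m}) (T_perms (Suc m))"
proof (rule bij_betw_byWitness[where f' =
      "\<lambda>q. (q \<circ> make_room m (inv q (Suc m)), inv q (Suc m))"])
  show "\<forall>a\<in>SIGMA p:T_perms m. {ldes m p<..Suc m}.
      (\<lambda>q. (q \<circ> make_room m (inv q (Suc m)), inv q (Suc m)))
        ((\<lambda>(p, k). insert_max m k p) a) = a"
  proof safe
    fix p k
    assume p: "p \<in> T_perms m" and "k \<in> {ldes m p<..Suc m}"
    then have k: "k \<in> {1..Suc m}" by auto
    have "inv p (Suc m) = Suc m"
      using permutes_inv[OF T_permsD(1)[OF p]] by (rule permutes_not_in) simp
    then have pos: "inv (insert_max m k p) (Suc m) = k"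
      by (simp add: inv_insert_max[OF k T_permsD(1)[OF p]])
    then show "inv (insert_max m k p) (Suc m) = k" .
    show "insert_max m k p \<circ> make_room m (inv (insert_max m k p) (Suc m)) = p"
      unfolding pos by (simp add: fun_eq_iff insert_max_make_room[OF k])
  qed
  have delete: "q \<circ> make_room m k \<in> T_perms m \<and> ldes m (q \<circ> make_room m k) < k
      \<and> k \<in> {1..Suc m} \<and> insert_max m k (q \<circ> make_room m k) = q"
    if q: "q \<in> T_perms (Suc m)" and k_def: "k = inv q (Suc m)" for q k
  proof -
    note q = T_permsD[OF q]
    have k: "k \<in> {1..Suc m}"
      unfolding k_def using permutes_in_image[OF permutes_inv[OF q(1)], of "Suc m"] by simp
    have room: "make_room m k permutes {1..Suc m}"
      by (rule make_room_permutes[OF k])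
    have insert: "insert_max m k (q \<circ> make_room m k) = q"
      using permutes_inverses(1)[OF room] by (simp add: insert_max_def fun_eq_iff)
    have perm: "q \<circ> make_room m k permutes {1..m}"
    proof (rule permutes_superset[where S = "{1..Suc m}"])
      show "q \<circ> make_room m k permutes {1..Suc m}"
        by (rule permutes_compose[OF room q(1)])
      fix i
      assume "i \<in> {1..Suc m} - {1..m}"
      then have "i = Suc m" by auto
      then show "(q \<circ> make_room m k) i = i"
        using permutes_inverses(1)[OF q(1)] by (simp add: k_def)
    qed
    show ?thesis
      using perm k insert q(2) avoids_321_insert_max_iff[OF k perm] by (simp add: T_perms_def)
  qed
  show "\<forall>q\<in>T_perms (Suc m). (\<lambda>(p, k). insert_max m k p)
      (q \<circ> make_room m (inv q (Suc m)), inv q (Suc m)) = q"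
    using delete by simp
  show "(\<lambda>(p, k). insert_max m k p) ` (SIGMA p:T_perms m. {ldes m p<..Suc m})
      \<subseteq> T_perms (Suc m)"
  proof safe
    fix p k
    assume p: "p \<in> T_perms m" and k: "k \<in> {ldes m p<..Suc m}"
    then have k': "k \<in> {1..Suc m}" by auto
    note p = T_permsD[OF p]
    show "insert_max m k p \<in> T_perms (Suc m)"
      using insert_max_permutes[OF k' p(1)] avoids_321_insert_max_iff[OF k' p(1)] p(2) k
      by (simp add: T_perms_def)
  qed
  show "(\<lambda>q. (q \<circ> make_room m (inv q (Suc m)), inv q (Suc m))) ` T_perms (Suc m)
      \<subseteq> (SIGMA p:T_perms m. {ldes m p<..Suc m})"
    using delete by auto
qed

section \<open>The statistics after an insertion\<close>

lemma lind_insert_max: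
  assumes "k \<in> {1..Suc m}" "p permutes {1..m}"
  shows "lind (Suc m) (insert_max m k p) = k"
proof -
  have "inv p (Suc m) = Suc m"
    using permutes_inv[OF assms(2)] by (rule permutes_not_in) simp
  then show ?thesis
    by (simp add: lind_def inv_insert_max[OF assms])
qed

text \<open>The old inversions are carried along by \<open>make_room\<close>; the new ones pair position \<open>k\<close>
  with each later position.\<close>

lemma inv_number_insert_max:
  assumes k: "k \<in> {1..Suc m}" and p: "p permutes {1..m}"
  shows "inv_number (Suc m) (insert_max m k p) = inv_number m p + (Suc m - k)"
proof -
  let ?q = "insert_max m k p" and ?e = "make_room m k"
  note q_e = insert_max_make_room[OF k, of p]
  note q_k = insert_max_at[OF k p]
  let ?I = "{(i, j). 1 \<le> i \<and> i < j \<and> j \<le> m \<and> p i > p j}"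
  let ?J = "{(i, j). 1 \<le> i \<and> i < j \<and> j \<le> Suc m \<and> ?q i > ?q j}"
  have J: "?J = map_prod ?e ?e ` ?I \<union> Pair k ` {k<..Suc m}"
  proof (intro equalityI subsetI)
    fix z
    assume "z \<in> ?J"
    then obtain i j where z: "z = (i, j)" and ij: "1 \<le> i" "i < j" "j \<le> Suc m" "?q i > ?q j"
      by auto
    have "j \<noteq> k"
      using ij q_k insert_max_le[OF k p, of i] by auto
    then obtain j' where j': "j = ?e j'" "j' \<in> {1..m}"
      using position_cases[OF k, of j] ij by auto
    show "z \<in> map_prod ?e ?e ` ?I \<union> Pair k ` {k<..Suc m}"
      using k
    proof (rule position_cases[where i = i])
      fix i'
      assume i': "i = ?e i'" "i' \<in> {1..m}"
      then have "(i', j') \<in> ?I"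
        using ij j' by (simp add: q_e make_room_less_iff)
      then show ?thesis
        using z i' j' by force
    qed (use z ij in auto)
  next
    fix z
    assume "z \<in> map_prod ?e ?e ` ?I \<union> Pair k ` {k<..Suc m}"
    then show "z \<in> ?J"
    proof
      assume "z \<in> map_prod ?e ?e ` ?I"
      then obtain i j where "z = (?e i, ?e j)" "(i, j) \<in> ?I" by auto
      then show "z \<in> ?J"
        using make_room_bounds[OF k, of i] make_room_bounds[OF k, of j]
        by (simp add: q_e make_room_less_iff)
    next
      assume "z \<in> Pair k ` {k<..Suc m}"
      then obtain j where z: "z = (k, j)" and j: "k < j" "j \<le> Suc m" by auto
      have "?q j \<noteq> ?q k"
        using j permutes_inj[OF insert_max_permutes[OF k p]] by (metis injD less_irrefl)
      then have "?q j < ?q k"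
        using insert_max_le[OF k p, of j] j q_k by simp
      then show "z \<in> ?J"
        using z j k by simp
    qed
  qed
  have inj: "inj_on (map_prod ?e ?e) ?I"
    using permutes_inj[OF make_room_permutes[OF k]]
    by (intro inj_on_subset[OF prod.inj_map]) auto
  have fin: "finite ?I"
    by (rule finite_subset[of _ "{..m} \<times> {..m}"]) auto
  have "map_prod ?e ?e ` ?I \<inter> Pair k ` {k<..Suc m} = {}"
    using k by (auto simp: make_room_def split: if_splits)
  then have "card ?J = card ?I + card (Pair k ` {k<..Suc m})"
    unfolding J using fin inj by (subst card_Un_disjoint) (auto simp: card_image)
  then show ?thesis
    by (simp add: inv_number_def card_image inj_on_def)
qed

text \<open>Before the end, the largest entry exceeds its right neighbour, and the entries
  to its right increase.\<close>

lemma ldes_insert_max: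
  assumes k: "ldes m p < k" "k \<le> m" and p: "p permutes {1..m}"
  shows "ldes (Suc m) (insert_max m k p) = k"
proof -
  let ?q = "insert_max m k p"
  have k': "k \<in> {1..Suc m}" using k by simp
  note q_k = insert_max_at[OF k' p]
  have "?q (Suc k) \<noteq> ?q k"
    using permutes_inj[OF insert_max_permutes[OF k' p]] by (metis injD n_not_Suc_n)
  then have "k \<in> Des (Suc m) ?q"
    using k insert_max_le[OF k' p, of "Suc k"] q_k by (simp add: Des_def)
  moreover have "i \<le> k" if "i \<in> Des (Suc m) ?q" for i
  proof (rule ccontr)
    assume "\<not> i \<le> k"
    then obtain i' where i': "i = Suc i'" "k \<le> i'"
      by (cases i) auto
    have "i' < m" and desc: "?q (Suc i) < ?q i"
      using that i' by (auto simp: Des_def)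
    \<comment> \<open>Positions beyond \<open>k\<close> are shifted by one, so this descent comes from one of \<open>p\<close> at \<open>i'\<close>.\<close>
    have "make_room m k i' = i" "make_room m k i = Suc i"
      using i' \<open>i' < m\<close> by (auto simp: make_room_def)
    then have "?q i = p i'" "?q (Suc i) = p i"
      using insert_max_make_room[OF k', of p] by metis+
    then show False
      using le_if_ldes_less[OF k(1), of i' i] i' \<open>i' < m\<close> desc by simp
  qed
  ultimately show ?thesis
    by (auto simp: ldes_def intro: Max_eqI)
qed

lemma ldes_append_max:
  assumes p: "p permutes {1..m}"
  shows "ldes (Suc m) (insert_max m (Suc m) p) = ldes m p"
proof -
  have "make_room m (Suc m) = id"
    by (auto simp: make_room_def)
  then have q: "insert_max m (Suc m) p = p"
    by (simp add: insert_max_def)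
  have "p (Suc m) = Suc m"
    using p by (rule permutes_not_in) simp
  moreover have "p m \<le> m"
    using permutes_in_image[OF p, of m] permutes_not_in[OF p, of m] by (cases "m = 0") auto
  \<comment> \<open>The larger size adds \<open>m\<close> as a candidate descent, which \<open>p m \<le> m < p (m + 1)\<close> excludes.\<close>
  ultimately have no_new: "i \<noteq> m" if "p (Suc i) < p i" for i
    using that by auto
  have "Des (Suc m) p = Des m p"
  proof (intro equalityI subsetI)
    fix i
    assume "i \<in> Des (Suc m) p"
    then show "i \<in> Des m p"
      using no_new[of i] by (auto simp: Des_def)
  qed (auto simp: Des_def)
  then show ?thesis
    by (simp add: q ldes_def)
qed

text \<open>Insertion keeps the relative order of the positions of the old entries, so only the
  pair \<open>m, m + 1\<close> can contribute a new descent to the inverse.\<close>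

lemma Des_inv_insert_max:
  assumes k: "k \<in> {1..Suc m}" and p: "p permutes {1..m}" and m: "1 \<le> m"
  shows "Des (Suc m) (inv (insert_max m k p)) =
    (if k \<le> lind m p then insert m (Des m (inv p)) else Des m (inv p))"
proof -
  note q = inv_insert_max[OF k p]
  have bounds: "inv p i \<in> {1..m}" if "i \<in> {1..m}" for i
    using permutes_in_image[OF permutes_inv[OF p]] that by simp
  have top: "inv p (Suc m) = Suc m"
    using permutes_inv[OF p] by (rule permutes_not_in) simp
  have old: "i \<in> Des (Suc m) (inv (insert_max m k p)) \<longleftrightarrow> i \<in> Des m (inv p)"
    if "i \<noteq> m" for i
    using that bounds[of i] bounds[of "Suc i"] by (auto simp: Des_def q make_room_less_iff)
  have new: "m \<in> Des (Suc m) (inv (insert_max m k p)) \<longleftrightarrow> k \<le> lind m p"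
    using bounds[of m] m by (simp add: Des_def q top less_make_room_iff lind_def)
  have "m \<notin> Des m (inv p)"
    using m by (auto simp: Des_def)
  then have "i \<in> Des (Suc m) (inv (insert_max m k p)) \<longleftrightarrow>
      i \<in> (if k \<le> lind m p then insert m (Des m (inv p)) else Des m (inv p))" for i
    using old[of i] new by (cases "i = m") auto
  then show ?thesis by blast
qed

section \<open>The recurrence\<close>

lemma geometric_telescope:
  fixes x u :: "'a::field"
  assumes "x \<noteq> 0" "a \<le> b" "b \<le> n"
  shows "(x - u) * (\<Sum>k\<in>{a<..b}. x ^ (n - k) * u ^ k) = x ^ n * u * ((u / x) ^ a - (u / x) ^ b)"
  using assms(2,3)
proof (induction b rule: dec_induct)
  case (step b)
  have split: "{a<..Suc b} = insert (Suc b) {a<..b}"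
    using step by auto
  define c where "c = n - Suc b"
  have n: "n = Suc (b + c)"
    using step by (simp add: c_def)
  have last: "(x - u) * (x ^ (n - Suc b) * u ^ Suc b)
      = x ^ n * u * ((u / x) ^ b - (u / x) ^ Suc b)"
    using assms(1) by (simp add: n field_simps power_add power_divide)
  have "(x - u) * (\<Sum>k\<in>{a<..Suc b}. x ^ (n - k) * u ^ k) =
      (x - u) * (x ^ (n - Suc b) * u ^ Suc b) + (x - u) * (\<Sum>k\<in>{a<..b}. x ^ (n - k) * u ^ k)"
    by (simp add: split distrib_left)
  also have "(x - u) * (\<Sum>k\<in>{a<..b}. x ^ (n - k) * u ^ k)
      = x ^ n * u * ((u / x) ^ a - (u / x) ^ b)"
    using step by simp
  finally show ?case
    unfolding last by (simp only: distrib_left[symmetric]) simp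
qed simp

definition weight :: "nat \<Rightarrow> (nat \<Rightarrow> 'a) \<Rightarrow> 'a \<Rightarrow> (nat \<Rightarrow> nat) \<Rightarrow> 'a::comm_semiring_1" where
  "weight n t x p = (\<Prod>i\<in>Des n (inv p). t i) * x ^ inv_number n p"

lemma f_gen_eq_sum_weight:
  "f_gen n t x y z = (\<Sum>p\<in>T_perms n. weight n t x p * y ^ ldes n p * z ^ lind n p)"
  by (simp add: f_gen_def weight_def)

lemma weight_insert_max:
  assumes "k \<in> {1..Suc m}" "p permutes {1..m}" "1 \<le> m"
  shows "weight (Suc m) t x (insert_max m k p) =
    weight m t x p * ((if k \<le> lind m p then t m else 1) * x ^ (Suc m - k))"
proof -
  have "m \<notin> Des m (inv p)"
    using assms(3) by (auto simp: Des_def)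
  then show ?thesis
    by (simp add: weight_def Des_inv_insert_max[OF assms] inv_number_insert_max[OF assms(1,2)]
        power_add mult_ac)
qed

text \<open>The contribution of all children of one permutation. The summation range is cut at
  \<open>lind p\<close>, where the factor \<open>t m\<close> disappears, and at \<open>m\<close>, since the child with
  the new entry at the end inherits its last descent.\<close>

lemma sum_children:
  fixes x y z :: "'a::field" and t :: "nat \<Rightarrow> 'a"
  assumes x: "x \<noteq> 0" and m: "1 \<le> m" and p: "p \<in> T_perms m"
  defines "w \<equiv> weight m t x p" and "d \<equiv> ldes m p" and "l \<equiv> lind m p" and "u \<equiv> y * z"
  shows "(x - u) * (\<Sum>k\<in>{d<..Suc m}. weight (Suc m) t x (insert_max m k p)
        * y ^ ldes (Suc m) (insert_max m k p) * z ^ lind (Suc m) (insert_max m k p))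
    = w * (t m * x ^ Suc m * u * (u / x) ^ d + (1 - t m) * x ^ Suc m * u * (u / x) ^ l
        + (x - u) * z ^ Suc m * y ^ d - x * u ^ Suc m)"
proof -
  have perm: "p permutes {1..m}"
    by (rule T_permsD(1)[OF p])
  have dl: "d \<le> l" and lm: "l \<le> m"
    using ldes_le_lind[OF p m] lind_bounds[OF perm m] by (auto simp: d_def l_def)
  define g where "g k = weight (Suc m) t x (insert_max m k p)
    * y ^ ldes (Suc m) (insert_max m k p) * z ^ lind (Suc m) (insert_max m k p)" for k
  define h where "h k = x ^ (Suc m - k) * u ^ k" for k
  have g: "g k = w * (if k \<le> l then t m else 1) * h k" if "d < k" "k \<le> m" for k
    using that by (simp add: g_def h_def w_def u_def l_def d_def weight_insert_max[OF _ perm m]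
        ldes_insert_max[OF _ _ perm] lind_insert_max[OF _ perm] power_mult_distrib mult_ac)
  have g_top: "g (Suc m) = w * (y ^ d * z ^ Suc m)"
    using lm by (simp add: g_def w_def l_def d_def weight_insert_max[OF _ perm m]
        ldes_append_max[OF perm] lind_insert_max[OF _ perm] mult_ac)
  have "{d<..Suc m} = insert (Suc m) {d<..m}"
    using dl lm by auto
  then have "sum g {d<..Suc m} = sum g {d<..m} + g (Suc m)"
    by (simp add: add.commute)
  also have "sum g {d<..m} = sum g {d<..l} + sum g {l<..m}"
    using dl lm by (subst sum.union_disjoint[symmetric]) (auto simp: ivl_disj_un)
  also have "sum g {d<..l} = w * t m * sum h {d<..l}"
    using lm by (simp add: sum_distrib_left g)
  also have "sum g {l<..m} = w * sum h {l<..m}"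
    using dl by (simp add: sum_distrib_left g)
  finally have "(x - u) * sum g {d<..Suc m} = w * (t m * ((x - u) * sum h {d<..l})
      + (x - u) * sum h {l<..m} + (x - u) * (y ^ d * z ^ Suc m))"
    by (simp add: g_top algebra_simps)
  also have "(x - u) * sum h {d<..l} = x ^ Suc m * u * ((u / x) ^ d - (u / x) ^ l)"
    unfolding h_def using lm by (intro geometric_telescope[OF x dl]) simp
  also have "(x - u) * sum h {l<..m} = x ^ Suc m * u * (u / x) ^ l - x * u ^ Suc m"
  proof -
    have "x ^ Suc m * u * (u / x) ^ m = x * u ^ Suc m"
      using x by (simp add: power_divide)
    then show ?thesis
      unfolding h_def using geometric_telescope[OF x lm, of "Suc m" u]
      by (simp add: right_diff_distrib)
  qed
  finally show ?thesis
    unfolding g_def by (simp add: algebra_simps)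
qed

lemma f_gen_Suc:
  fixes x y z :: "'a::field"
  assumes x: "x \<noteq> 0" and m: "1 \<le> m"
  shows "(x - y * z) * f_gen (Suc m) t x y z =
      t m * x ^ Suc m * y * z * f_gen m t x (y * z / x) 1
      + (1 - t m) * x ^ Suc m * y * z * f_gen m t x 1 (y * z / x)
      + (x - y * z) * z ^ Suc m * f_gen m t x y 1
      - x * y ^ Suc m * z ^ Suc m * f_gen m t x 1 1"
proof -
  define g where
    "g q = weight (Suc m) t x q * y ^ ldes (Suc m) q * z ^ lind (Suc m) q" for q
  have "f_gen (Suc m) t x y z =
      (\<Sum>(p, k)\<in>(SIGMA p:T_perms m. {ldes m p<..Suc m}). g (insert_max m k p))"
    unfolding f_gen_eq_sum_weight g_def[symmetric]
    by (subst sum.reindex_bij_betw[OF bij_betw_insert_max, symmetric]) (simp add: case_prod_beta)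
  also have "\<dots> = (\<Sum>p\<in>T_perms m. \<Sum>k\<in>{ldes m p<..Suc m}. g (insert_max m k p))"
    by (subst sum.Sigma) auto
  finally have "(x - y * z) * f_gen (Suc m) t x y z =
      (\<Sum>p\<in>T_perms m. (x - y * z) * (\<Sum>k\<in>{ldes m p<..Suc m}. g (insert_max m k p)))"
    by (simp add: sum_distrib_left)
  also have "\<dots> = (\<Sum>p\<in>T_perms m. weight m t x p *
      (t m * x ^ Suc m * (y * z) * (y * z / x) ^ ldes m p
        + (1 - t m) * x ^ Suc m * (y * z) * (y * z / x) ^ lind m p
        + (x - y * z) * z ^ Suc m * y ^ ldes m p - x * (y * z) ^ Suc m))"
    unfolding g_def by (intro sum.cong refl sum_children[OF x m])
  also have "\<dots> = t m * x ^ Suc m * y * z * f_gen m t x (y * z / x) 1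
      + (1 - t m) * x ^ Suc m * y * z * f_gen m t x 1 (y * z / x)
      + (x - y * z) * z ^ Suc m * f_gen m t x y 1
      - x * y ^ Suc m * z ^ Suc m * f_gen m t x 1 1"
    unfolding f_gen_eq_sum_weight sum_distrib_left sum.distrib[symmetric] sum_subtractf[symmetric]
    by (intro sum.cong refl) (simp only: power_one mult_1_left mult_1_right power_mult_distrib ring_distribs mult_ac)
  finally show ?thesis .
qed

lemma f_gen_1: "f_gen 1 t x y z = z"
proof -
  have "T_perms 1 = {id}"
    by (auto simp: T_perms_def avoids_321_def)
  moreover have "inv_number 1 id = 0"
  proof -
    have "{(i, j). 1 \<le> i \<and> i < j \<and> j \<le> 1 \<and> id i > (id j :: nat)} = {}"
      by auto
    then show ?thesis
      unfolding inv_number_def by (metis card.empty)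
  qed
  moreover have "Des 1 p = {}" for p
    by (simp add: Des_def)
  ultimately show ?thesis
    by (simp add: f_gen_def ldes_def lind_def)
qed

lemma var_x_nonzero: "var_x \<noteq> 0"
proof -
  have "Poly_Mapping.single (Poly_Mapping.single (0::nat) (1::nat)) (1::int) \<noteq> 0"
    by simp
  then show ?thesis
    by (simp add: var_x_def indet_def Zero_fract_def eq_fract)
qed

theorem theorem2p1:
  shows "f_gen 1 var_t var_x var_y var_z = var_z \<and>
    (\<forall>n\<ge>2.
      (var_x - var_y * var_z) * f_gen n var_t var_x var_y var_z =
        var_t (n - 1) * var_x ^ n * var_y * var_z
          * f_gen (n - 1) var_t var_x (var_y * var_z / var_x) 1
        + (1 - var_t (n - 1)) * var_x ^ n * var_y * var_z
          * f_gen (n - 1) var_t var_x 1 (var_y * var_z / var_x)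
        + (var_x - var_y * var_z) * var_z ^ n * f_gen (n - 1) var_t var_x var_y 1
        - var_x * var_y ^ n * var_z ^ n * f_gen (n - 1) var_t var_x 1 1)"
proof (intro conjI allI impI)
  show "f_gen 1 var_t var_x var_y var_z = var_z"
    by (rule f_gen_1)
next
  fix n :: nat
  assume n: "2 \<le> n"
  define m where "m = n - 1"
  have "n = Suc m" "1 \<le> m"
    using n by (simp_all add: m_def)
  then show "(var_x - var_y * var_z) * f_gen n var_t var_x var_y var_z =
        var_t (n - 1) * var_x ^ n * var_y * var_z
          * f_gen (n - 1) var_t var_x (var_y * var_z / var_x) 1
        + (1 - var_t (n - 1)) * var_x ^ n * var_y * var_z
          * f_gen (n - 1) var_t var_x 1 (var_y * var_z / var_x)
        + (var_x - var_y * var_z) * var_z ^ n * f_gen (n - 1) var_t var_x var_y 1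
        - var_x * var_y ^ n * var_z ^ n * f_gen (n - 1) var_t var_x 1 1"
    using f_gen_Suc[OF var_x_nonzero, of m var_y var_z var_t] by simp
qed

end
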